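(* Consider completely positive trace-preserving (CPTP) maps $\Phi:M_d(\mathbb C)\to M_d(\mathbb C)$. Fix two distinct basis labels $i\ne j$ and fix the transition probabilities $P_{ri}=p(r|i)$ and $P_{rj}=p(r|j)$ for all $r$, where $p(r|k):=\langle r|\Phi(|k\rangle\langle k|)|r\rangle$. Put $a_r:=\sqrt{P_{ri}P_{rj}}$. If there exists an output basis label $r_0$ such that $$a_{r_0}>\sum_{r\ne r_0}a_r,$$ then no CPTP map $\Phi$ with these transition probabilities can simultaneously saturate (i.e. satisfy with equality, for every $r$) all the bounds $$\bigl|\langle r|\Phi(|i\rangle\langle j|)|r\rangle\bigr|\le a_r .$$ In particular, no thermal operation with these transition probabilities can do so.
   Context: $\{|r\rangle\}_{r=1}^d$ is a fixed orthonormal basis of $\mathbb C^d$; the displayed bounds hold for every CPTP map with the given transition probabilities. When thermal operations are discussed, the basis is an eigenbasis of a system Hamiltonian $H_S$, and a thermal operation is a map $\Phi(\rho)=\mathrm{Tr}_B[U(\rho\otimes\tau_B)U^\dagger]$ with a finite-dimensional bath of Hamiltonian $H_B$, $\tau_B=e^{-\beta H_B}/\mathrm{Tr}(e^{-\beta H_B})$, and $U$ unitary with $[U,H_S+H_B]=0$ (in particular it is CPTP). *)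

theory Defs
  imports "HOL-Analysis.Analysis"
begin

text \<open>
  Complex vectors and matrices are \<open>complex ^ 'n\<close> and \<open>complex ^ 'n ^ 'n\<close>; the library inner
  product on \<open>complex ^ 'n\<close> is the real one, hence the Hermitian inner product below, conjugate
  linear in its first argument.
\<close>

definition cinner :: "complex ^ 'n \<Rightarrow> complex ^ 'n \<Rightarrow> complex" where
  "cinner x y = (\<Sum>k\<in>UNIV. cnj (x $ k) * y $ k)"

definition ketbra :: "complex ^ 'n \<Rightarrow> complex ^ 'n \<Rightarrow> complex ^ 'n ^ 'n" where
  "ketbra x y = (\<chi> a b. x $ a * cnj (y $ b))"

text \<open>The family is indexed by the coordinate type itself, so an orthonormal family is a basis.\<close>

definition orthonormal_basis :: "('n \<Rightarrow> complex ^ 'n) \<Rightarrow> bool" where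
  "orthonormal_basis e \<longleftrightarrow> (\<forall>r s. cinner (e r) (e s) = (if r = s then 1 else 0))"

definition diag_elem :: "('n \<Rightarrow> complex ^ 'n) \<Rightarrow> complex ^ 'n ^ 'n \<Rightarrow> 'n \<Rightarrow> complex" where
  "diag_elem e X r = cinner (e r) (X *v e r)"

definition mscale :: "complex \<Rightarrow> complex ^ 'n ^ 'm \<Rightarrow> complex ^ 'n ^ 'm" where
  "mscale c A = (\<chi> a b. c * A $ a $ b)"

definition dagger :: "complex ^ 'n ^ 'm \<Rightarrow> complex ^ 'm ^ 'n" where
  "dagger A = (\<chi> a b. cnj (A $ b $ a))"

definition hermitian :: "complex ^ 'n ^ 'n \<Rightarrow> bool" where
  "hermitian A \<longleftrightarrow> dagger A = A"

definition unitary :: "complex ^ 'n ^ 'n \<Rightarrow> bool" where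
  "unitary U \<longleftrightarrow> dagger U ** U = mat 1 \<and> U ** dagger U = mat 1"

lemma vector_space_mscale: "vector_space (mscale :: complex \<Rightarrow> complex ^ 'n ^ 'm \<Rightarrow> _)"
  by unfold_locales (simp_all add: mscale_def vec_eq_iff algebra_simps)

text \<open>
  A \<open>k \<times> k\<close> block matrix with blocks in \<open>M\<^sub>n\<close> is an element of \<open>M\<^sub>k \<otimes> M\<^sub>n\<close>, and
  \<open>id\<^sub>k \<otimes> \<Phi>\<close> applies \<open>\<Phi>\<close> to each block. Blocks with an index \<open>\<ge> k\<close> are irrelevant.
\<close>

definition psd_block_matrix :: "nat \<Rightarrow> (nat \<Rightarrow> nat \<Rightarrow> complex ^ 'n ^ 'n) \<Rightarrow> bool" where
  "psd_block_matrix k A \<longleftrightarrow>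
     (\<forall>x :: nat \<Rightarrow> complex ^ 'n. (\<Sum>p<k. \<Sum>q<k. cinner (x p) (A p q *v x q)) \<in> \<real>\<^sub>\<ge>\<^sub>0)"

definition completely_positive :: "(complex ^ 'n ^ 'n \<Rightarrow> complex ^ 'm ^ 'm) \<Rightarrow> bool" where
  "completely_positive \<Phi> \<longleftrightarrow>
     (\<forall>k A. psd_block_matrix k A \<longrightarrow> psd_block_matrix k (\<lambda>p q. \<Phi> (A p q)))"

definition trace_preserving :: "(complex ^ 'n ^ 'n \<Rightarrow> complex ^ 'm ^ 'm) \<Rightarrow> bool" where
  "trace_preserving \<Phi> \<longleftrightarrow> (\<forall>X. trace (\<Phi> X) = trace X)"

definition cptp :: "(complex ^ 'n ^ 'n \<Rightarrow> complex ^ 'm ^ 'm) \<Rightarrow> bool" where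
  "cptp \<Phi> \<longleftrightarrow>
     Vector_Spaces.linear mscale mscale \<Phi> \<and> completely_positive \<Phi> \<and> trace_preserving \<Phi>"

definition tensor ::
  "complex ^ 'n ^ 'n \<Rightarrow> complex ^ 'b ^ 'b \<Rightarrow> complex ^ ('n::finite \<times> 'b::finite) ^ ('n \<times> 'b)" where
  "tensor A B = (\<chi> p q. A $ fst p $ fst q * B $ snd p $ snd q)"

text \<open>Partial trace over the second factor.\<close>

definition ptrace_bath :: "complex ^ ('n::finite \<times> 'b::finite) ^ ('n \<times> 'b) \<Rightarrow> complex ^ 'n ^ 'n" where
  "ptrace_bath M = (\<chi> a c. \<Sum>b\<in>UNIV. M $ (a, b) $ (c, b))"

text \<open>
  Multiplication of the type class \<open>times\<close> on \<open>_ ^ _\<close> is componentwise, so matrix powers are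
  iterates of \<open>(**)\<close>.
\<close>

definition matrix_exp :: "complex ^ 'n ^ 'n \<Rightarrow> complex ^ 'n ^ 'n" where
  "matrix_exp A = (\<Sum>n. (((**) A) ^^ n) (mat 1) /\<^sub>R fact n)"

definition gibbs_state :: "real \<Rightarrow> complex ^ 'b ^ 'b \<Rightarrow> complex ^ 'b ^ 'b" where
  "gibbs_state \<beta> H =
     mscale (1 / trace (matrix_exp (mscale (- complex_of_real \<beta>) H)))
       (matrix_exp (mscale (- complex_of_real \<beta>) H))"

text \<open>
  The bath Hilbert space is \<open>complex ^ 'b\<close> for the type \<open>'b\<close> of the first argument; a statement
  with \<open>'b\<close> free ranges over all finite bath dimensions.
\<close>

definition thermal_operation ::
  "'b::finite itself \<Rightarrow> real \<Rightarrow> complex ^ 'n ^ 'n \<Rightarrow>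
     (complex ^ 'n ^ 'n \<Rightarrow> complex ^ 'n ^ 'n) \<Rightarrow> bool" where
  "thermal_operation _ \<beta> HS \<Phi> \<longleftrightarrow>
     (\<exists>(HB :: complex ^ 'b ^ 'b) (U :: complex ^ ('n::finite \<times> 'b::finite) ^ ('n \<times> 'b)).
        hermitian HB \<and> unitary U \<and>
        U ** (tensor HS (mat 1) + tensor (mat 1) HB)
          = (tensor HS (mat 1) + tensor (mat 1) HB) ** U \<and>
        (\<forall>\<rho>. \<Phi> \<rho> = ptrace_bath (U ** tensor \<rho> (gibbs_state \<beta> HB) ** dagger U)))"

definition eigenbasis :: "complex ^ 'n ^ 'n \<Rightarrow> ('n \<Rightarrow> complex ^ 'n) \<Rightarrow> bool" where
  "eigenbasis H e \<longleftrightarrow>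
     orthonormal_basis e \<and> (\<forall>r. \<exists>E::real. H *v e r = complex_of_real E *s e r)"

definition has_transition_probs ::
  "('n \<Rightarrow> complex ^ 'n) \<Rightarrow> ('n \<Rightarrow> 'n \<Rightarrow> real) \<Rightarrow> 'n set \<Rightarrow>
     (complex ^ 'n ^ 'n \<Rightarrow> complex ^ 'n ^ 'n) \<Rightarrow> bool" where
  "has_transition_probs e P K \<Phi> \<longleftrightarrow>
     (\<forall>k\<in>K. \<forall>r. diag_elem e (\<Phi> (ketbra (e k) (e k))) r = complex_of_real (P r k))"

end

(* The diagonal entries of Phi(|i><j|) sum to its trace, which vanishes because <i|j> = 0 and Phi
   preserves the trace. By the triangle inequality no entry of a vanishing sum exceeds in modulus
   the sum of the moduli of the others, so the moduli cannot be the numbers a r. A thermal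
   operation keeps traces zero because Tr(Phi(X)) = Tr(X) Tr(tau_B). *)
theory Submission
  imports Defs
begin

text \<open>The trace does not depend on the orthonormal basis: with the vectors \<open>e r\<close>
  as columns of \<open>V\<close>, the numbers \<open>diag_elem e X r\<close> are the diagonal
  entries of \<open>dagger V ** X ** V\<close>, and the trace is cyclic.\<close>

lemma sum_diag_elem:
  fixes e :: "'n::finite \<Rightarrow> complex ^ 'n"
  assumes "orthonormal_basis e"
  shows "(\<Sum>r\<in>UNIV. diag_elem e X r) = trace X"
proof -
  define V :: "complex ^ 'n ^ 'n" where "V = (\<chi> a r. e r $ a)"
  have "dagger V ** V = mat 1"
    using assms
    by (simp add: vec_eq_iff matrix_matrix_mult_def mat_def dagger_def V_def
        orthonormal_basis_def cinner_def)
  \<comment> \<open>For the square matrix \<open>V\<close> a left inverse is a right inverse, so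
    orthonormality yields completeness of the basis.\<close>
  then have V: "V ** dagger V = mat 1"
    by (simp add: matrix_left_right_inverse)
  have "diag_elem e X r = (dagger V ** (X ** V)) $ r $ r" for r
    by (simp add: diag_elem_def cinner_def matrix_vector_mult_def matrix_matrix_mult_def
        dagger_def V_def)
  then have "(\<Sum>r\<in>UNIV. diag_elem e X r) = trace (dagger V ** (X ** V))"
    by (simp add: trace_def)
  also have "\<dots> = trace (X ** (V ** dagger V))"
    by (simp add: trace_mul_sym[of "dagger V"] flip: matrix_mul_assoc)
  finally show ?thesis
    by (simp add: V)
qed

lemma trace_ketbra: "trace (ketbra x y) = cinner y x"
  by (simp add: trace_def ketbra_def cinner_def mult.commute)

lemma trace_ptrace_bath: "trace (ptrace_bath M) = trace M"
  by (simp add: trace_def ptrace_bath_def sum.cartesian_product flip: UNIV_Times_UNIV)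

lemma trace_tensor: "trace (tensor A B) = trace A * trace B"
  by (simp add: trace_def tensor_def sum_product sum.cartesian_product case_prod_beta
      flip: UNIV_Times_UNIV)

lemma trace_unitary_conj:
  assumes "unitary U"
  shows "trace (U ** X ** dagger U) = trace X"
proof -
  have "trace (U ** X ** dagger U) = trace (dagger U ** U ** X)"
    by (simp add: trace_mul_sym[of "U ** X"] matrix_mul_assoc)
  with assms show ?thesis
    by (simp add: unitary_def)
qed

text \<open>Restricted to traceless \<open>X\<close>, where the product of \<open>trace X\<close>
  and the trace of the Gibbs state is zero whatever the second factor is.\<close>

lemma trace_thermal_operation_eq_0:
  assumes "thermal_operation T \<beta> HS \<Phi>" and "trace X = 0"
  shows "trace (\<Phi> X) = 0"
  using assms
  by (auto simp: thermal_operation_def trace_ptrace_bath trace_unitary_conj trace_tensor)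

lemma norm_le_sum_norm_others_if_sum_eq_0:
  fixes f :: "'a \<Rightarrow> 'b::real_normed_vector"
  assumes "finite A" and "x \<in> A" and "sum f A = 0"
  shows "norm (f x) \<le> (\<Sum>y\<in>A - {x}. norm (f y))"
proof -
  have "f x = - sum f (A - {x})"
    using assms by (simp add: sum_diff1)
  then show ?thesis
    by (simp add: norm_sum)
qed

theorem theorem4:
  fixes e :: "'d::finite \<Rightarrow> complex ^ 'd"
    and i j :: 'd
    and P :: "'d \<Rightarrow> 'd \<Rightarrow> real"
    and a :: "'d \<Rightarrow> real"
  assumes basis: "orthonormal_basis e"
    and ij: "i \<noteq> j"
    and a_def: "\<And>r. a r = sqrt (P r i * P r j)"
    and dominant: "\<exists>r0. a r0 > (\<Sum>r\<in>UNIV - {r0}. a r)"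
  shows "(\<nexists>\<Phi>. cptp \<Phi> \<and> has_transition_probs e P {i, j} \<Phi> \<and>
            (\<forall>r. cmod (diag_elem e (\<Phi> (ketbra (e i) (e j))) r) = a r)) \<and>
         (\<forall>HS \<beta>. hermitian HS \<and> eigenbasis HS e \<longrightarrow>
            (\<nexists>\<Phi>. thermal_operation TYPE('b::finite) \<beta> HS \<Phi> \<and>
               has_transition_probs e P {i, j} \<Phi> \<and>
               (\<forall>r. cmod (diag_elem e (\<Phi> (ketbra (e i) (e j))) r) = a r)))"
proof -
  \<comment> \<open>Common core of both conjuncts, to be used with \<open>X\<close> the image of
    \<open>ketbra (e i) (e j)\<close>.\<close>
  have not_saturated: "\<not> (\<forall>r. cmod (diag_elem e X r) = a r)" if "trace X = 0" for X
  proof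
    assume sat: "\<forall>r. cmod (diag_elem e X r) = a r"
    \<comment> \<open>Under saturation the moduli of the diagonal entries are the
      \<open>a r\<close>, so the triangle inequality rules out a dominant label.\<close>
    have "a r \<le> (\<Sum>s\<in>UNIV - {r}. a s)" for r
      using norm_le_sum_norm_others_if_sum_eq_0[of UNIV r "diag_elem e X"]
        sum_diag_elem[OF basis, of X] that sat by simp
    with dominant show False
      by (meson not_less)
  qed
  have coherence: "trace (ketbra (e i) (e j)) = 0"
    using basis ij by (simp add: trace_ketbra orthonormal_basis_def)
  have "trace (\<Phi> (ketbra (e i) (e j))) = 0" if "cptp \<Phi>"
    for \<Phi> :: "complex ^ 'd ^ 'd \<Rightarrow> complex ^ 'd ^ 'd"
    using that coherence by (simp add: cptp_def trace_preserving_def)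
  then show ?thesis
    using not_saturated trace_thermal_operation_eq_0[OF _ coherence] by blast
qed

end
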